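(* Let $n$ be a natural number. For all $1\leq k\leq n+1$, $$\lvert \mathrm{Tr}_{k}([n])\rvert = \mathrm{NC}_{n+1}(k)=\frac{1}{n+1}\binom{n+1}{k}\binom{n+1}{k-1}.$$
   Context: $[n]$ is the poset $\{0<1<\dots<n\}$. A transfer system on $[n]$ is a partial order $\mathcal{R}$ on the set $\{0,\dots,n\}$ that refines $\leq$ (i.e. $i\,\mathcal{R}\,j$ implies $i\leq j$) and such that if $i\,\mathcal{R}\,j$ and $k\leq j$ then $\min(i,k)\,\mathcal{R}\,k$. For a binary relation $\mathcal{F}$ on $[n]$ refining $\leq$, $\langle\mathcal{F}\rangle$ is the minimal transfer system containing $\mathcal{F}$, and $\mathcal{F}$ is called a generating set for $\langle\mathcal{F}\rangle$. The minimal generating number of a transfer system $\mathcal{R}$ is the minimal cardinality of a generating set for $\mathcal{R}$ (relations being viewed as sets of ordered pairs, called edges). $\mathrm{Tr}_k([n])$ is the set of transfer systems on $[n]$ minimally generated by $k$ edges, i.e. with minimal generating number $k$. A partition of $\{0,\dots,n\}$ is noncrossing if whenever $0\leq a<b<c<d\leq n$ are such that $a,c$ are in the same class and $b,d$ are in the same class, then $a,b,c,d$ are all in the same class. $\mathrm{NC}_{n+1}$ is the set of all noncrossing partitions of $\{0,\dots,n\}$. The rank of $\pi\in\mathrm{NC}_{n+1}$ is $n+1-\mathrm{bk}(\pi)$, where $\mathrm{bk}(\pi)$ is the number of blocks of $\pi$, and $\mathrm{NC}_{n+1}(k)$ denotes the number of partitions in $\mathrm{NC}_{n+1}$ with rank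 $k$.
   Formalization: The printed closed formula is off by one in the index (n=2, k=1: the count is 3, the formula gives 1); proved instead are |Tr_k([n])| = NC_{n+1}(k) as printed, and the closed formula as the value of |Tr_{k-1}([n])| = NC_{n+1}(k-1). *)

theory Defs
  imports Complex_Main "HOL-Library.Disjoint_Sets"
begin

definition le_rel :: "nat \<Rightarrow> (nat \<times> nat) set" where
  "le_rel n = {(i, j). i \<le> j \<and> j \<le> n}"

definition transfer_system :: "nat \<Rightarrow> (nat \<times> nat) set \<Rightarrow> bool" where
  "transfer_system n R \<longleftrightarrow>
     partial_order_on {0..n} R \<and> R \<subseteq> le_rel n \<and>
     (\<forall>i j k. (i, j) \<in> R \<and> k \<le> j \<longrightarrow> (min i k, k) \<in> R)"

text \<open>The least element is taken with respect to inclusion; it exists whenever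
  \<open>F\<close> refines \<open>\<le>\<close>, see \<open>transfer_closure_eq_Inter\<close> below.\<close>
definition transfer_closure :: "nat \<Rightarrow> (nat \<times> nat) set \<Rightarrow> (nat \<times> nat) set" where
  "transfer_closure n F = (LEAST R. transfer_system n R \<and> F \<subseteq> R)"

definition generating_set :: "nat \<Rightarrow> (nat \<times> nat) set \<Rightarrow> (nat \<times> nat) set \<Rightarrow> bool" where
  "generating_set n F R \<longleftrightarrow> F \<subseteq> le_rel n \<and> transfer_closure n F = R"

definition min_generating_number :: "nat \<Rightarrow> (nat \<times> nat) set \<Rightarrow> nat" where
  "min_generating_number n R = (LEAST m. \<exists>F. generating_set n F R \<and> card F = m)"

definition Tr :: "nat \<Rightarrow> nat \<Rightarrow> (nat \<times> nat) set set" where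
  "Tr k n = {R. transfer_system n R \<and> min_generating_number n R = k}"

definition noncrossing :: "nat \<Rightarrow> nat set set \<Rightarrow> bool" where
  "noncrossing n P \<longleftrightarrow>
     (\<forall>a b c d. a < b \<and> b < c \<and> c < d \<and> d \<le> n \<and>
        (\<exists>B\<in>P. a \<in> B \<and> c \<in> B) \<and> (\<exists>B\<in>P. b \<in> B \<and> d \<in> B)
        \<longrightarrow> (\<exists>B\<in>P. {a, b, c, d} \<subseteq> B))"

text \<open>The partitions in \<open>NC n\<close> are those of the \<open>n + 1\<close> points \<open>0, \<dots>, n\<close>, so this set is
  usually written with the index \<open>n + 1\<close>.\<close>
definition NC :: "nat \<Rightarrow> nat set set set" where
  "NC n = {P. partition_on {0..n} P \<and> noncrossing n P}"

text \<open>The subtraction does not truncate: a partition of \<open>{0..n}\<close> has at most \<open>n + 1\<close> blocks.\<close>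
definition nc_rank :: "nat \<Rightarrow> nat set set \<Rightarrow> nat" where
  "nc_rank n P = n + 1 - card P"

definition num_NC_of_rank :: "nat \<Rightarrow> nat \<Rightarrow> nat" where
  "num_NC_of_rank n k = card {P \<in> NC n. nc_rank n P = k}"

lemma transfer_system_le_rel: "transfer_system n (le_rel n)"
  by (auto simp: transfer_system_def le_rel_def partial_order_on_def preorder_on_def
      refl_on_def trans_def antisym_def)

lemma transfer_system_Inter:
  assumes "\<A> \<noteq> {}" "\<And>R. R \<in> \<A> \<Longrightarrow> transfer_system n R"
  shows "transfer_system n (\<Inter>\<A>)"
proof -
  obtain R0 where R0: "R0 \<in> \<A>" using assms(1) by blast
  have 1: "refl_on {0..n} R \<and> trans R \<and> R \<subseteq> {0..n} \<times> {0..n} \<and> antisym R \<and> R \<subseteq> le_rel n \<and>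
      (\<forall>i j k. (i, j) \<in> R \<and> k \<le> j \<longrightarrow> (min i k, k) \<in> R)" if "R \<in> \<A>" for R
    using assms(2)[OF that] by (auto simp: transfer_system_def partial_order_on_def preorder_on_def)
  have "refl_on {0..n} (\<Inter>\<A>)" using 1 by (auto simp: refl_on_def)
  moreover have "trans (\<Inter>\<A>)" using 1 by (meson InterE InterI transD transI)
  moreover have "antisym (\<Inter>\<A>)" using 1[OF R0] R0 by (meson InterE antisymD antisymI)
  moreover have "\<Inter>\<A> \<subseteq> {0..n} \<times> {0..n}" "\<Inter>\<A> \<subseteq> le_rel n" using 1[OF R0] R0 by blast+
  moreover have "\<forall>i j k. (i, j) \<in> \<Inter>\<A> \<and> k \<le> j \<longrightarrow> (min i k, k) \<in> \<Inter>\<A>" using 1 by blast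
  ultimately show ?thesis
    by (simp add: transfer_system_def partial_order_on_def preorder_on_def)
qed

lemma transfer_closure_eq_Inter:
  assumes "F \<subseteq> le_rel n"
  shows "transfer_closure n F = \<Inter>{R. transfer_system n R \<and> F \<subseteq> R}"
  unfolding transfer_closure_def
proof (rule Least_equality)
  show "transfer_system n (\<Inter>{R. transfer_system n R \<and> F \<subseteq> R}) \<and>
      F \<subseteq> \<Inter>{R. transfer_system n R \<and> F \<subseteq> R}"
    using transfer_system_le_rel[of n] assms by (intro conjI transfer_system_Inter) auto
qed auto

end

theory Submission
  imports Defs
begin

text \<open>Let \<open>m i\<close> be the largest \<open>j\<close> with \<open>(i, j) \<in> R\<close> for a transfer system \<open>R\<close>, respectively the
  maximum of the block of \<open>i\<close> for a noncrossing partition. Either object is determined by \<open>m\<close>, and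
  in both cases the functions that arise are those with \<open>i \<le> m i\<close> and \<open>m j \<le> m i\<close> whenever
  \<open>i \<le> j \<le> m i\<close>. The minimal generating number and the rank both count the \<open>i\<close> with \<open>m i \<noteq> i\<close>.
  We encode \<open>m\<close> as the list of the differences \<open>m i - i\<close>. Such lists are counted by building them from
  the right: the number \<open>s\<close> of values that may be put in front becomes \<open>s + 1\<close> if the new entry is
  \<open>0\<close>, and otherwise takes each value in \<open>2, \<dots>, s\<close> exactly once. This recursion has a closed
  solution in binomial coefficients.\<close>

section \<open>Bracket vectors\<close>

text \<open>These are the bracket vectors of Huang and Tamari: the intervals from \<open>i\<close>
  to \<open>i + xs ! i\<close> are pairwise nested or disjoint. Storing differences makes the
  conditions invariant under shifts, so they pass to the tail of a list. The points
  \<open>0, ..., n\<close> correspond to length \<open>Suc n\<close>.\<close>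

definition bracket_vectors :: "nat \<Rightarrow> nat list set" where
  "bracket_vectors n = {xs. length xs = n \<and>
     (\<forall>i<n. i + xs ! i < n \<and> (\<forall>j. i \<le> j \<and> j \<le> i + xs ! i \<longrightarrow> j + xs ! j \<le> i + xs ! i))}"

definition nonzeros :: "nat list \<Rightarrow> nat" where
  "nonzeros xs = length (filter (\<lambda>d. d \<noteq> 0) xs)"

lemma nonzeros_eq_card: "nonzeros xs = card {i. i < length xs \<and> xs ! i \<noteq> 0}"
  by (simp add: nonzeros_def length_filter_conv_card)

lemma bracket_vectorsD:
  assumes "xs \<in> bracket_vectors n"
  shows "length xs = n"
    and "i < n \<Longrightarrow> i + xs ! i < n"
    and "i < n \<Longrightarrow> i \<le> j \<Longrightarrow> j \<le> i + xs ! i \<Longrightarrow> j + xs ! j \<le> i + xs ! i"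
  using assms by (auto simp: bracket_vectors_def)

text \<open>An interval starting at the right end of another has to stay inside it. So the zero
  entries mark exactly the right ends.\<close>

lemma bracket_vectors_endpoint:
  assumes "xs \<in> bracket_vectors n" "i < n"
  shows "xs ! (i + xs ! i) = 0"
  using bracket_vectorsD(3)[OF assms, of "i + xs ! i"] by simp

lemma finite_bracket_vectors [simp]: "finite (bracket_vectors n)"
proof (rule finite_subset)
  show "bracket_vectors n \<subseteq> {xs. set xs \<subseteq> {..n} \<and> length xs = n}"
  proof
    fix xs assume xs: "xs \<in> bracket_vectors n"
    have "xs ! i \<le> n" if "i < n" for i
      using bracket_vectorsD(2)[OF xs that] by simp
    thus "xs \<in> {xs. set xs \<subseteq> {..n} \<and> length xs = n}"
      using bracket_vectorsD(1)[OF xs] by (auto simp: in_set_conv_nth)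
  qed
qed (simp add: finite_lists_length_eq)

subsection \<open>Transfer systems\<close>

lemma transfer_systemD:
  assumes "transfer_system n R"
  shows "(i, j) \<in> R \<Longrightarrow> i \<le> j" "(i, j) \<in> R \<Longrightarrow> j \<le> n"
    and "i \<le> n \<Longrightarrow> (i, i) \<in> R"
    and "(i, j) \<in> R \<Longrightarrow> (j, k) \<in> R \<Longrightarrow> (i, k) \<in> R"
    and "(i, j) \<in> R \<Longrightarrow> i \<le> k \<Longrightarrow> k \<le> j \<Longrightarrow> (i, k) \<in> R"
proof -
  have R: "refl_on {0..n} R" "trans R" "R \<subseteq> le_rel n"
      "\<And>i j k. (i, j) \<in> R \<Longrightarrow> k \<le> j \<Longrightarrow> (min i k, k) \<in> R"
    using assms by (auto simp: transfer_system_def partial_order_on_def preorder_on_def)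
  show "(i, j) \<in> R \<Longrightarrow> i \<le> j" "(i, j) \<in> R \<Longrightarrow> j \<le> n" using R(3) by (auto simp: le_rel_def)
  show "i \<le> n \<Longrightarrow> (i, i) \<in> R" using R(1) by (auto simp: refl_on_def)
  show "(i, j) \<in> R \<Longrightarrow> (j, k) \<in> R \<Longrightarrow> (i, k) \<in> R" using R(2) by (rule transD)
  show "(i, j) \<in> R \<Longrightarrow> i \<le> k \<Longrightarrow> k \<le> j \<Longrightarrow> (i, k) \<in> R"
    using R(4)[of i j k] by (simp add: min_def)
qed

text \<open>For \<open>k < i\<close> the restriction axiom only asks for the loop at
  \<open>k\<close>, so it amounts to reflexivity together with lowering the target of an
  edge.\<close>

lemma transfer_systemI:
  assumes "\<And>i j. (i, j) \<in> R \<Longrightarrow> i \<le> j \<and> j \<le> n"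
    and "\<And>i. i \<le> n \<Longrightarrow> (i, i) \<in> R"
    and "\<And>i j k. (i, j) \<in> R \<Longrightarrow> (j, k) \<in> R \<Longrightarrow> (i, k) \<in> R"
    and "\<And>i j k. (i, j) \<in> R \<Longrightarrow> i \<le> k \<Longrightarrow> k \<le> j \<Longrightarrow> (i, k) \<in> R"
  shows "transfer_system n R"
  unfolding transfer_system_def partial_order_on_def preorder_on_def
proof (intro conjI allI impI)
  show "R \<subseteq> {0..n} \<times> {0..n}" "R \<subseteq> le_rel n"
    using assms(1) unfolding le_rel_def by fastforce+
  show "refl_on {0..n} R" using assms(2) by (auto simp: refl_on_def)
  show "trans R" using assms(3) by (rule transI)
  show "antisym R"
  proof (rule antisymI)
    fix i j assume "(i, j) \<in> R" "(j, i) \<in> R"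
    thus "i = j" using assms(1)[of i j] assms(1)[of j i] by linarith
  qed
  fix i j k assume "(i, j) \<in> R \<and> k \<le> j"
  thus "(min i k, k) \<in> R"
    using assms(1)[of i j] assms(2)[of k] assms(4)[of i j k]
    by (cases "i \<le> k") (simp_all add: min_def)
qed

lemma finite_le_rel: "finite (le_rel n)"
  by (rule finite_subset[of _ "{0..n} \<times> {0..n}"]) (auto simp: le_rel_def)

lemma transfer_closure_least:
  assumes "F \<subseteq> le_rel n" "transfer_system n R" "F \<subseteq> R"
  shows "transfer_closure n F \<subseteq> R"
  using transfer_closure_eq_Inter[OF assms(1)] assms(2,3) by blast

text \<open>Neither restriction nor composition creates an edge with a new source, so a generating
  set needs one edge for every source; the longest edge at each source suffices.\<close>

lemma sources_subset_generators:
  assumes "generating_set n F R"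
  shows "fst ` (R - Id) \<subseteq> fst ` F"
proof -
  \<comment> \<open>The largest relation inside \<open>le_rel n\<close> whose non-loops start at
    sources of \<open>F\<close>. As a transfer system containing \<open>F\<close>, it bounds the
    closure from above.\<close>
  define R' where "R' = {(i, j). i \<le> j \<and> j \<le> n \<and> (i = j \<or> i \<in> fst ` F)}"
  have F: "F \<subseteq> le_rel n" "transfer_closure n F = R"
    using assms by (auto simp: generating_set_def)
  have "transfer_system n R'"
    by (rule transfer_systemI) (auto simp: R'_def)
  moreover have "F \<subseteq> R'" using F(1) by (force simp: R'_def le_rel_def)
  ultimately have "R \<subseteq> R'" using transfer_closure_least F by blast
  thus ?thesis by (auto simp: R'_def)
qed

lemma generating_set_longest_edges:
  assumes R: "transfer_system n R"
  shows "generating_set n ((\<lambda>i. (i, Max {j. (i, j) \<in> R})) ` fst ` (R - Id)) R"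
    (is "generating_set n ?F R")
proof -
  have fin: "finite {j. (i, j) \<in> R}" for i
    by (rule finite_subset[of _ "{0..n}"]) (auto dest: transfer_systemD(2)[OF R])
  have FR: "?F \<subseteq> R"
  proof
    fix e assume "e \<in> ?F"
    then obtain i j where ij: "e = (i, Max {j. (i, j) \<in> R})" "(i, j) \<in> R" by force
    have "Max {j. (i, j) \<in> R} \<in> {j. (i, j) \<in> R}"
      by (rule Max_in[OF fin]) (use ij in auto)
    thus "e \<in> R" using ij by simp
  qed
  have Fle: "?F \<subseteq> le_rel n"
    using FR R by (auto simp: transfer_system_def)
  have "R \<subseteq> R'" if R': "transfer_system n R'" "?F \<subseteq> R'" for R'
  proof clarify
    fix i j assume ij: "(i, j) \<in> R"
    show "(i, j) \<in> R'"
    proof (cases "i = j")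
      case True
      thus ?thesis using transfer_systemD(2)[OF R ij] transfer_systemD(3)[OF R'(1)] by simp
    next
      case False
      hence "i \<in> fst ` (R - Id)" using ij by force
      hence "(i, Max {j. (i, j) \<in> R}) \<in> R'" using R'(2) by blast
      \<comment> \<open>Every edge out of \<open>i\<close> is the longest one with its target
        lowered.\<close>
      thus ?thesis
        by (rule transfer_systemD(5)[OF R'(1)])
           (use ij fin transfer_systemD(1)[OF R ij] in auto)
    qed
  qed
  hence "transfer_closure n ?F = R"
    using R FR by (subst transfer_closure_eq_Inter[OF Fle]) blast
  thus ?thesis using Fle by (simp add: generating_set_def)
qed

lemma min_generating_number_eq:
  assumes R: "transfer_system n R"
  shows "min_generating_number n R = card (fst ` (R - Id))"
  unfolding min_generating_number_def
proof (rule Least_equality)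
  show "\<exists>F. generating_set n F R \<and> card F = card (fst ` (R - Id))"
    by (intro exI conjI, rule generating_set_longest_edges[OF R], rule card_image)
       (auto intro: inj_onI)
next
  fix m assume "\<exists>F. generating_set n F R \<and> card F = m"
  then obtain F where F: "generating_set n F R" "card F = m" by blast
  \<comment> \<open>An infinite \<open>F\<close> would have \<open>card F = 0\<close>, which would
    break the lower bound.\<close>
  have "finite F" using F(1) finite_le_rel finite_subset by (auto simp: generating_set_def)
  hence "card (fst ` (R - Id)) \<le> card (fst ` F)" "card (fst ` F) \<le> card F"
    using sources_subset_generators[OF F(1)] by (auto intro: card_mono card_image_le)
  thus "card (fst ` (R - Id)) \<le> m" using F(2) by simp
qed

section \<open>Transfer systems as bracket vectors\<close>

definition rel_of :: "nat list \<Rightarrow> (nat \<times> nat) set" where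
  "rel_of xs = {(i, j). i < length xs \<and> i \<le> j \<and> j \<le> i + xs ! i}"

text \<open>Transitivity is the nesting of the intervals; lowering of targets is built into
  \<open>rel_of\<close>.\<close>

lemma transfer_system_rel_of:
  assumes "xs \<in> bracket_vectors (Suc n)"
  shows "transfer_system n (rel_of xs)"
proof (rule transfer_systemI)
  note xs = bracket_vectorsD[OF assms]
  show "i \<le> j \<and> j \<le> n" if "(i, j) \<in> rel_of xs" for i j
    using that xs(1) xs(2)[of i] by (auto simp: rel_of_def)
  show "(i, k) \<in> rel_of xs" if "(i, j) \<in> rel_of xs" "(j, k) \<in> rel_of xs" for i j k
    using that xs(1) xs(3)[of i j] by (auto simp: rel_of_def)
qed (use bracket_vectorsD(1)[OF assms] in \<open>auto simp: rel_of_def\<close>)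

lemma sources_rel_of: "fst ` (rel_of xs - Id) = {i. i < length xs \<and> xs ! i \<noteq> 0}"
proof -
  have "i \<in> fst ` (rel_of xs - Id)" if "i < length xs" "xs ! i \<noteq> 0" for i
    by (rule image_eqI[of _ _ "(i, i + xs ! i)"]) (use that in \<open>auto simp: rel_of_def\<close>)
  thus ?thesis by (auto simp: rel_of_def)
qed

text \<open>The longest edge out of \<open>i\<close> ends at \<open>i + xs ! i\<close>, so the entry
  can be read off the relation.\<close>

lemma inj_on_rel_of: "inj_on rel_of (bracket_vectors n)"
proof (rule inj_onI)
  fix xs ys assume a: "xs \<in> bracket_vectors n" "ys \<in> bracket_vectors n" "rel_of xs = rel_of ys"
  show "xs = ys"
  proof (rule nth_equalityI)
    show len: "length xs = length ys" using a by (auto dest: bracket_vectorsD)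
    fix i assume "i < length xs"
    moreover from this have "(i, i + xs ! i) \<in> rel_of xs" "(i, i + ys ! i) \<in> rel_of ys"
      using len by (auto simp: rel_of_def)
    hence "(i, i + xs ! i) \<in> rel_of ys" "(i, i + ys ! i) \<in> rel_of xs"
      using a(3) by auto
    ultimately show "xs ! i = ys ! i" by (auto simp: rel_of_def)
  qed
qed

lemma rel_of_surj:
  assumes R: "transfer_system n R"
  obtains xs where "xs \<in> bracket_vectors (Suc n)" "rel_of xs = R"
proof -
  define m where "m i = Max {j. (i, j) \<in> R}" for i
  have fin: "finite {j. (i, j) \<in> R}" for i
    by (rule finite_subset[of _ "{0..n}"]) (auto dest: transfer_systemD(2)[OF R])
  have mR: "(i, m i) \<in> R" if "i \<le> n" for i
    using Max_in[OF fin, of i] transfer_systemD(3)[OF R that] by (auto simp: m_def)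
  have m_ge: "j \<le> m i" if "(i, j) \<in> R" for i j
    using that fin by (auto simp: m_def)
  have le_m: "i \<le> m i" "m i \<le> n" if "i \<le> n" for i
    using transfer_systemD(1,2)[OF R mR[OF that]] by auto
  define xs where "xs = map (\<lambda>i. m i - i) [0..<Suc n]"
  have nth: "i + xs ! i = m i" if "i \<le> n" for i
    using that le_m(1)[OF that] by (simp add: xs_def del: upt_Suc)
  have len: "length xs = Suc n" by (simp add: xs_def)
  \<comment> \<open>Nesting comes from transitivity: lower the longest edge at \<open>i\<close> to
    target \<open>j\<close>, then compose it with the longest edge at \<open>j\<close>.\<close>
  have "m j \<le> m i" if "i \<le> n" "i \<le> j" "j \<le> m i" for i j
  proof (rule m_ge)
    have "(i, j) \<in> R" using mR[OF that(1)] that(2,3) by (rule transfer_systemD(5)[OF R])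
    moreover have "(j, m j) \<in> R" using mR le_m(2)[OF that(1)] that(3) by simp
    ultimately show "(i, m j) \<in> R" by (rule transfer_systemD(4)[OF R])
  qed
  moreover have "j \<le> n" if "i \<le> n" "j \<le> m i" for i j
    using le_m(2)[OF that(1)] that(2) by simp
  ultimately have "xs \<in> bracket_vectors (Suc n)"
    using nth len le_m by (simp add: bracket_vectors_def less_Suc_eq_le)
  moreover have "rel_of xs = R"
  proof (rule set_eqI, clarify)
    fix i j
    have "(i, j) \<in> rel_of xs \<longleftrightarrow> i \<le> n \<and> i \<le> j \<and> j \<le> m i"
      using nth len by (auto simp: rel_of_def)
    also have "\<dots> \<longleftrightarrow> (i, j) \<in> R"
      using mR m_ge transfer_systemD[OF R] by (meson le_trans)
    finally show "(i, j) \<in> rel_of xs \<longleftrightarrow> (i, j) \<in> R" .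
  qed
  ultimately show thesis by (rule that)
qed

lemma card_Tr: "card (Tr k n) = card {xs \<in> bracket_vectors (Suc n). nonzeros xs = k}"
proof -
  have "Tr k n = rel_of ` {xs \<in> bracket_vectors (Suc n). nonzeros xs = k}"
  proof (intro equalityI subsetI)
    fix R assume "R \<in> Tr k n"
    hence R: "transfer_system n R" "min_generating_number n R = k" by (auto simp: Tr_def)
    obtain xs where xs: "xs \<in> bracket_vectors (Suc n)" "rel_of xs = R"
      using rel_of_surj[OF R(1)] .
    thus "R \<in> rel_of ` {xs \<in> bracket_vectors (Suc n). nonzeros xs = k}"
      using R min_generating_number_eq[OF R(1)] sources_rel_of[of xs] nonzeros_eq_card[of xs]
      by auto
  next
    fix R assume "R \<in> rel_of ` {xs \<in> bracket_vectors (Suc n). nonzeros xs = k}"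
    then obtain xs where "xs \<in> bracket_vectors (Suc n)" "nonzeros xs = k" "R = rel_of xs"
      by blast
    thus "R \<in> Tr k n"
      using transfer_system_rel_of[of xs n] min_generating_number_eq[of n "rel_of xs"]
        sources_rel_of[of xs] nonzeros_eq_card[of xs] by (simp add: Tr_def)
  qed
  moreover have "inj_on rel_of {xs \<in> bracket_vectors (Suc n). nonzeros xs = k}"
    using inj_on_rel_of by (rule inj_on_subset) auto
  ultimately show ?thesis by (simp add: card_image)
qed

subsection \<open>Noncrossing partitions\<close>

text \<open>The blocks are the fibres of \<open>i + xs ! i\<close>. For a bracket vector its values
  are exactly the positions of zero entries, and each of these lies in its own fibre, so no block is
  empty.\<close>

definition partition_of :: "nat list \<Rightarrow> nat set set" where
  "partition_of xs =
     (\<lambda>v. {j. j < length xs \<and> j + xs ! j = v}) ` {v. v < length xs \<and> xs ! v = 0}"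

lemma block_partition_of:
  assumes xs: "xs \<in> bracket_vectors n"
  shows "(\<exists>B\<in>partition_of xs. i \<in> B \<and> j \<in> B) \<longleftrightarrow> i < n \<and> j < n \<and> i + xs ! i = j + xs ! j"
proof
  assume "i < n \<and> j < n \<and> i + xs ! i = j + xs ! j"
  thus "\<exists>B\<in>partition_of xs. i \<in> B \<and> j \<in> B"
    using bracket_vectorsD(1)[OF xs] bracket_vectorsD(2)[OF xs, of i] bracket_vectors_endpoint[OF xs, of i]
    by (auto simp: partition_of_def intro!: bexI[of _ "i + xs ! i"])
qed (auto simp: partition_of_def bracket_vectorsD(1)[OF xs])

lemma partition_of_NC:
  assumes xs: "xs \<in> bracket_vectors (Suc n)"
  shows "partition_of xs \<in> NC n"
proof -
  note D = bracket_vectorsD[OF xs]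
  have "partition_on {0..n} (partition_of xs)"
  proof (rule partition_onI)
    show "\<Union> (partition_of xs) = {0..n}"
    proof (rule set_eqI)
      show "i \<in> \<Union> (partition_of xs) \<longleftrightarrow> i \<in> {0..n}" for i
        using block_partition_of[OF xs, of i i] by auto
    qed
    show "{} \<notin> partition_of xs"
      by (auto simp: partition_of_def)
  qed (auto simp: partition_of_def disjnt_def)
  moreover have "noncrossing n (partition_of xs)"
    unfolding noncrossing_def
  proof (intro allI impI, elim conjE)
    fix a b c d
    assume ord: "a < b" "b < c" "c < d" "d \<le> n"
      and "\<exists>B\<in>partition_of xs. a \<in> B \<and> c \<in> B" "\<exists>B\<in>partition_of xs. b \<in> B \<and> d \<in> B"
    hence eq: "a + xs ! a = c + xs ! c" "b + xs ! b = d + xs ! d"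
      using block_partition_of[OF xs] by blast+
    \<comment> \<open>Write \<open>m i\<close> for \<open>i + xs ! i\<close>. Then
      \<open>b < c \<le> m c = m a\<close> puts \<open>b\<close> inside the interval of
      \<open>a\<close>, and \<open>c < d \<le> m d = m b\<close> puts \<open>c\<close> inside that
      of \<open>b\<close>. So \<open>m b \<le> m a = m c \<le> m b\<close>.\<close>
    have "b + xs ! b \<le> a + xs ! a" using D(3)[of a b] ord eq by simp
    moreover have "c + xs ! c \<le> b + xs ! b" using D(3)[of b c] ord eq by simp
    ultimately have eq': "a + xs ! a = b + xs ! b" using eq by simp
    obtain B where "B \<in> partition_of xs" "a \<in> B" "b \<in> B"
      using block_partition_of[OF xs, of a b] eq' ord by auto
    moreover from this have "c \<in> B" "d \<in> B"
      using eq eq' ord D(1) by (auto simp: partition_of_def)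
    ultimately show "\<exists>B\<in>partition_of xs. {a, b, c, d} \<subseteq> B" by blast
  qed
  ultimately show ?thesis by (simp add: NC_def)
qed

text \<open>Each block contains exactly one zero entry, at its maximum, so the zeros count the
  blocks and the other entries give the rank.\<close>

lemma nc_rank_partition_of:
  assumes xs: "xs \<in> bracket_vectors (Suc n)"
  shows "nc_rank n (partition_of xs) = nonzeros xs"
proof -
  note len = bracket_vectorsD(1)[OF xs]
  have "card (partition_of xs) = card {v. v < length xs \<and> xs ! v = 0}"
    unfolding partition_of_def
  proof (intro card_image inj_onI)
    fix v w assume v: "v \<in> {v. v < length xs \<and> xs ! v = 0}" and
      eq: "{j. j < length xs \<and> j + xs ! j = v} = {j. j < length xs \<and> j + xs ! j = w}"
    have "v \<in> {j. j < length xs \<and> j + xs ! j = v}" using v by simp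
    hence "v \<in> {j. j < length xs \<and> j + xs ! j = w}" by (simp only: eq)
    thus "v = w" using v by simp
  qed
  also have "\<dots> + nonzeros xs = Suc n"
    using sum_length_filter_compl[of "\<lambda>d. d = 0" xs] len
    by (simp add: nonzeros_def length_filter_conv_card)
  finally show ?thesis by (simp add: nc_rank_def)
qed

lemma inj_on_partition_of: "inj_on partition_of (bracket_vectors n)"
proof (rule inj_onI)
  fix xs ys
  assume xs: "xs \<in> bracket_vectors n" and ys: "ys \<in> bracket_vectors n"
    and eq: "partition_of xs = partition_of ys"
  note len = bracket_vectorsD(1)[OF xs] bracket_vectorsD(1)[OF ys]
  have same: "i + xs ! i = j + xs ! j \<longleftrightarrow> i + ys ! i = j + ys ! j" if "i < n" "j < n" for i j
    using block_partition_of[OF xs, of i j] block_partition_of[OF ys, of i j] eq that by simp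
  \<comment> \<open>The point \<open>i\<close> shares its \<open>us\<close>-block with
    \<open>i + us ! i\<close>, hence also its \<open>vs\<close>-block. So the right end
    \<open>i + vs ! i\<close> of the latter is at least \<open>i + us ! i\<close>. Using this both
    ways gives equality.\<close>
  have le: "us ! i \<le> vs ! i" if "us \<in> bracket_vectors n" "i < n"
    "\<And>i j. i < n \<Longrightarrow> j < n \<Longrightarrow> i + us ! i = j + us ! j \<Longrightarrow> i + vs ! i = j + vs ! j" for us vs i
    using that(3)[of i "i + us ! i"] bracket_vectorsD(2)[OF that(1,2)]
      bracket_vectors_endpoint[OF that(1,2)] that(2) by simp
  have "xs ! i = ys ! i" if "i < n" for i
    using le[OF xs that] le[OF ys that] same by (simp add: antisym)
  thus "xs = ys" using len by (intro nth_equalityI) simp_all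
qed

lemma partition_of_surj:
  assumes P: "P \<in> NC n"
  obtains xs where "xs \<in> bracket_vectors (Suc n)" "partition_of xs = P"
proof -
  have part: "partition_on {0..n} P" and nc: "noncrossing n P"
    using P by (auto simp: NC_def)
  have un: "\<Union> P = {0..n}" using part by (rule partition_onD1[symmetric])
  have uniq: "B = C" if "B \<in> P" "C \<in> P" "i \<in> B" "i \<in> C" for B C i
    using partition_onD2[OF part] that by (auto simp: disjoint_def)
  define bl where "bl i = (THE B. B \<in> P \<and> i \<in> B)" for i
  have bl_eq: "bl i = B" if "B \<in> P" "i \<in> B" for i B
    unfolding bl_def using that uniq by (intro the_equality) auto
  have bl: "bl i \<in> P" "i \<in> bl i" if "i \<le> n" for i
  proof -
    have "i \<in> \<Union> P" using un that by simp
    then obtain B where "B \<in> P" "i \<in> B" by blast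
    thus "bl i \<in> P" "i \<in> bl i" using bl_eq by auto
  qed
  have in_n: "i \<le> n" if "B \<in> P" "i \<in> B" for B i using un that by auto
  have fin: "finite B" if "B \<in> P" for B
    by (rule finite_subset[of _ "{0..n}"]) (use in_n[OF that] in auto)
  define m where "m i = Max (bl i)" for i
  have m_in: "m i \<in> bl i" if "i \<le> n" for i
    unfolding m_def using bl[OF that] fin by (intro Max_in) auto
  have m_ge: "j \<le> m i" if "i \<le> n" "j \<in> bl i" for i j
    unfolding m_def using bl[OF that(1)] fin that by auto
  have le_m: "i \<le> m i" "m i \<le> n" if "i \<le> n" for i
    using m_ge[OF that] m_in[OF that] bl[OF that] in_n by auto
  have bl_m: "bl (m i) = bl i" if "i \<le> n" for i
    using m_in[OF that] bl(1)[OF that] by (rule bl_eq[rotated])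
  have m_eq: "m i = m j \<longleftrightarrow> bl i = bl j" if "i \<le> n" "j \<le> n" for i j
    using bl_m[OF that(1)] bl_m[OF that(2)] by (metis m_def)
  define xs where "xs = map (\<lambda>i. m i - i) [0..<Suc n]"
  have nth: "i + xs ! i = m i" if "i \<le> n" for i
    using that le_m(1)[OF that] by (simp add: xs_def del: upt_Suc)
  have len: "length xs = Suc n" by (simp add: xs_def)
  have "m j \<le> m i" if ij: "i \<le> n" "i \<le> j" "j \<le> m i" for i j
  \<comment> \<open>Otherwise \<open>i < j < m i < m j\<close> with \<open>i, m i\<close> in one
    block and \<open>j, m j\<close> in another, which is a crossing.\<close>
  proof (rule ccontr)
    assume "\<not> m j \<le> m i"
    hence lt: "m i < m j" by simp
    have j: "j \<le> n" using le_m(2)[OF ij(1)] ij(3) by simp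
    have ne: "bl i \<noteq> bl j" using lt by (auto simp: m_def)
    have "i < j" using ij ne by (cases "i = j") auto
    moreover have "j < m i" using ij ne bl_m[OF ij(1)] by (cases "j = m i") auto
    moreover have "\<exists>B\<in>P. i \<in> B \<and> m i \<in> B" using bl m_in ij(1) by blast
    moreover have "\<exists>B\<in>P. j \<in> B \<and> m j \<in> B" using bl m_in j by blast
    ultimately obtain B where "B \<in> P" "{i, j, m i, m j} \<subseteq> B"
      using nc lt le_m(2)[OF j] unfolding noncrossing_def by blast
    hence "bl i = bl j" using bl_eq by simp
    thus False using ne by simp
  qed
  moreover have "j \<le> n" if "i \<le> n" "j \<le> m i" for i j
    using le_m(2)[OF that(1)] that(2) by simp
  ultimately have xs: "xs \<in> bracket_vectors (Suc n)"
    using nth len le_m by (simp add: bracket_vectors_def less_Suc_eq_le)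
  moreover have "partition_of xs = P"
  proof -
    have "xs ! v = 0 \<longleftrightarrow> m v = v" if "v \<le> n" for v using nth[OF that] by linarith
    hence "partition_of xs = (\<lambda>v. {j. j \<le> n \<and> m j = v}) ` {v. v \<le> n \<and> m v = v}"
      unfolding partition_of_def
      by (intro image_cong) (use nth len in \<open>auto simp: less_Suc_eq_le\<close>)
    \<comment> \<open>The fibre of \<open>m\<close> over a block maximum \<open>v\<close> is the
      block of \<open>v\<close>, and every block has a maximum.\<close>
    also have "\<dots> = (\<lambda>v. bl v) ` {v. v \<le> n \<and> m v = v}"
    proof (rule image_cong[OF refl])
      fix v assume "v \<in> {v. v \<le> n \<and> m v = v}"
      hence v: "v \<le> n" "m v = v" by auto
      have "j \<le> n \<and> m j = v \<longleftrightarrow> j \<in> bl v" for j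
        using m_eq[OF _ v(1), of j] v bl[OF v(1)] bl_eq[of "bl v" j] in_n[of "bl v" j] bl[of j]
        by auto
      thus "{j. j \<le> n \<and> m j = v} = bl v" by auto
    qed
    also have "\<dots> = P"
    proof (intro equalityI subsetI)
      fix B assume B: "B \<in> P"
      then obtain i where i: "i \<in> B" using partition_onD3[OF part] by (metis ex_in_conv)
      have in': "i \<le> n" using in_n[OF B i] .
      have "B = bl (m i)" using bl_m[OF in'] bl_eq[OF B i] by simp
      moreover have "m (m i) = m i" using bl_m[OF in'] by (simp add: m_def)
      ultimately show "B \<in> (\<lambda>v. bl v) ` {v. v \<le> n \<and> m v = v}"
        using le_m(2)[OF in'] by blast
    qed (use bl in auto)
    finally show ?thesis .
  qed
  ultimately show thesis by (rule that)
qed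

lemma num_NC_of_rank_eq:
  "num_NC_of_rank n k = card {xs \<in> bracket_vectors (Suc n). nonzeros xs = k}"
proof -
  have "{P \<in> NC n. nc_rank n P = k} =
    partition_of ` {xs \<in> bracket_vectors (Suc n). nonzeros xs = k}"
  proof (intro equalityI subsetI)
    fix P assume "P \<in> {P \<in> NC n. nc_rank n P = k}"
    hence P: "P \<in> NC n" "nc_rank n P = k" by auto
    obtain xs where "xs \<in> bracket_vectors (Suc n)" "partition_of xs = P"
      using partition_of_surj[OF P(1)] .
    thus "P \<in> partition_of ` {xs \<in> bracket_vectors (Suc n). nonzeros xs = k}"
      using P nc_rank_partition_of by auto
  qed (auto simp: partition_of_NC nc_rank_partition_of)
  moreover have "inj_on partition_of {xs \<in> bracket_vectors (Suc n). nonzeros xs = k}"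
    using inj_on_partition_of by (rule inj_on_subset) auto
  ultimately show ?thesis by (simp add: num_NC_of_rank_def card_image)
qed

subsection \<open>Counting bracket vectors\<close>

text \<open>These are the values that may precede \<open>xs\<close>. In \<open>d # xs\<close> the
  first interval covers the old positions below \<open>d\<close>, so no interval starting there may
  reach \<open>d\<close>. In other words, \<open>d\<close> is a cut that no interval
  crosses.\<close>

definition heads :: "nat list \<Rightarrow> nat set" where
  "heads xs = {d. d \<le> length xs \<and> (\<forall>j<d. j + xs ! j < d)}"

lemma finite_heads [simp]: "finite (heads xs)"
  by (rule finite_subset[of _ "{..length xs}"]) (auto simp: heads_def)

lemma zero_in_heads [simp]: "0 \<in> heads xs"
  by (simp add: heads_def)

text \<open>By shift invariance the conditions at later positions are those of \<open>xs\<close>;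
  the conditions at position 0 say that \<open>d\<close> is a head.\<close>

lemma Cons_in_bracket_vectors:
  "d # xs \<in> bracket_vectors (Suc n) \<longleftrightarrow> xs \<in> bracket_vectors n \<and> d \<in> heads xs"
proof
  assume a: "d # xs \<in> bracket_vectors (Suc n)"
  note D = bracket_vectorsD[OF a]
  have "length xs = n" using D(1) by simp
  moreover have "i + xs ! i < n" if "i < n" for i using D(2)[of "Suc i"] that by simp
  moreover have "j + xs ! j \<le> i + xs ! i" if "i < n" "i \<le> j" "j \<le> i + xs ! i" for i j
    using D(3)[of "Suc i" "Suc j"] that by simp
  moreover have "d \<le> n" using D(2)[of 0] by simp
  moreover have "j + xs ! j < d" if "j < d" for j using D(3)[of 0 "Suc j"] that by simp
  ultimately show "xs \<in> bracket_vectors n \<and> d \<in> heads xs"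
    by (simp add: bracket_vectors_def heads_def)
next
  assume "xs \<in> bracket_vectors n \<and> d \<in> heads xs"
  hence xs: "xs \<in> bracket_vectors n" and d: "d \<le> n" "\<And>j. j < d \<Longrightarrow> j + xs ! j < d"
    using bracket_vectorsD(1) by (auto simp: heads_def)
  note D = bracket_vectorsD[OF xs]
  have "i + (d # xs) ! i < Suc n" if "i < Suc n" for i
    using that d(1) D(2) by (cases i) auto
  moreover have "j + (d # xs) ! j \<le> i + (d # xs) ! i"
    if "i < Suc n" "i \<le> j" "j \<le> i + (d # xs) ! i" for i j
  proof (cases i)
    case 0
    thus ?thesis using that d(2)[of "j - 1"] by (cases j) auto
  next
    case (Suc i')
    then obtain j' where "j = Suc j'" using \<open>i \<le> j\<close> by (cases j) auto
    thus ?thesis using Suc that D(3)[of i' j'] by simp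
  qed
  ultimately show "d # xs \<in> bracket_vectors (Suc n)"
    using D(1) by (simp add: bracket_vectors_def)
qed

text \<open>A cut at \<open>Suc e\<close> must lie beyond the new first interval, which means
  \<open>d \<le> e\<close>, and must cut \<open>xs\<close> at \<open>e\<close>. So prepending
  \<open>d\<close> destroys the heads below \<open>d\<close>, shifts the others and adds 0.\<close>

lemma heads_Cons: "heads (d # xs) = insert 0 (Suc ` {e \<in> heads xs. d \<le> e})"
proof (intro set_eqI)
  fix e
  show "e \<in> heads (d # xs) \<longleftrightarrow> e \<in> insert 0 (Suc ` {e \<in> heads xs. d \<le> e})"
  proof (cases e)
    case (Suc e')
    have "(\<forall>j<Suc e'. j + (d # xs) ! j < Suc e') \<longleftrightarrow> d \<le> e' \<and> (\<forall>j<e'. j + xs ! j < e')"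
      unfolding All_less_Suc2 by (simp add: less_Suc_eq_le Suc_le_eq)
    hence "e \<in> heads (d # xs) \<longleftrightarrow> e' \<in> heads xs \<and> d \<le> e'"
      unfolding heads_def Suc mem_Collect_eq by (simp only: list.size(4) Suc_le_mono) auto
    thus ?thesis using Suc by blast
  qed simp
qed

lemma card_heads_Cons: "card (heads (d # xs)) = Suc (card {e \<in> heads xs. d \<le> e})"
  by (simp add: heads_Cons card_insert_if card_image)

text \<open>Upper sections shrink strictly as \<open>d\<close> grows, whence uniqueness. For
  existence, \<open>Min A\<close> has the full section, and removing it leaves the sections of the
  other elements unchanged.\<close>

lemma ex1_upper_section_card:
  fixes A :: "nat set"
  assumes "finite A" "1 \<le> r" "r \<le> card A"
  shows "\<exists>!d. d \<in> A \<and> card {e \<in> A. d \<le> e} = r"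
proof (rule ex_ex1I)
  show "\<exists>d. d \<in> A \<and> card {e \<in> A. d \<le> e} = r"
    using assms
  proof (induction "card A" arbitrary: A)
    case (Suc c)
    have "A \<noteq> {}" using Suc.hyps(2) by auto
    hence Min: "Min A \<in> A" using Suc.prems(1) by simp
    show ?case
    proof (cases "r = card A")
      case True
      have "{e \<in> A. Min A \<le> e} = A" using Suc.prems(1) by auto
      thus ?thesis using True Min by (intro exI[of _ "Min A"]) simp
    next
      case False
      have c: "c = card (A - {Min A})" using Suc.hyps(2) Min by simp
      have "r \<le> c" using False Suc.prems(3) Suc.hyps(2) by linarith
      hence "\<exists>d. d \<in> A - {Min A} \<and> card {e \<in> A - {Min A}. d \<le> e} = r"
        using Suc.prems(1,2) c by (intro Suc.hyps(1)) simp_all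
      then obtain d where d: "d \<in> A - {Min A}" "card {e \<in> A - {Min A}. d \<le> e} = r"
        by blast
      have "Min A < d" using d(1) Suc.prems(1) by (simp add: order.not_eq_order_implies_strict)
      hence "{e \<in> A - {Min A}. d \<le> e} = {e \<in> A. d \<le> e}" by auto
      thus ?thesis using d by (intro exI[of _ d]) simp
    qed
  next
    case 0
    thus ?case by linarith
  qed
next
  have lt: "card {e \<in> A. d' \<le> e} < card {e \<in> A. d \<le> e}" if "d \<in> A" "d < d'" for d d'
  proof (rule psubset_card_mono)
    have "d \<in> {e \<in> A. d \<le> e}" "d \<notin> {e \<in> A. d' \<le> e}" using that by simp_all
    thus "{e \<in> A. d' \<le> e} \<subset> {e \<in> A. d \<le> e}" using that(2) by fastforce
  qed (use assms(1) in simp)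
  fix d d' assume "d \<in> A \<and> card {e \<in> A. d \<le> e} = r" "d' \<in> A \<and> card {e \<in> A. d' \<le> e} = r"
  thus "d = d'" using lt[of d d'] lt[of d' d] by (metis nat_neq_iff)
qed

text \<open>This recognises the zero entry from the head counts: it alone preserves all heads of the
  tail.\<close>

lemma upper_section_card_full_iff:
  fixes A :: "nat set"
  assumes "finite A" "0 \<in> A" "d \<in> A"
  shows "card {e \<in> A. d \<le> e} = card A \<longleftrightarrow> d = 0"
proof
  assume "card {e \<in> A. d \<le> e} = card A"
  hence "{e \<in> A. d \<le> e} = A" using assms(1) by (intro card_subset_eq) auto
  thus "d = 0" using assms(2) by blast
qed simp

section \<open>Recursion by heads and nonzero entries\<close>

text \<open>The heads are the boundaries of the maximal intervals, so \<open>Suc r\<close> heads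
  mean \<open>r\<close> maximal intervals; hence the shift by one.\<close>

definition bv_count :: "nat \<Rightarrow> nat \<Rightarrow> nat \<Rightarrow> nat" where
  "bv_count n r k =
     card {xs \<in> bracket_vectors n. nonzeros xs = k \<and> card (heads xs) = Suc r}"

definition bv_count_ge :: "nat \<Rightarrow> nat \<Rightarrow> nat \<Rightarrow> nat" where
  "bv_count_ge n r k =
     card {xs \<in> bracket_vectors n. nonzeros xs = k \<and> Suc r \<le> card (heads xs)}"

lemma card_heads_le: "xs \<in> bracket_vectors n \<Longrightarrow> card (heads xs) \<le> Suc n"
  using card_mono[of "{..n}" "heads xs"] bracket_vectorsD(1)[of xs n] by (auto simp: heads_def)

lemma card_heads_ge: "xs \<in> bracket_vectors (Suc n) \<Longrightarrow> Suc (Suc 0) \<le> card (heads xs)"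
proof -
  assume "xs \<in> bracket_vectors (Suc n)"
  hence "{0, Suc n} \<subseteq> heads xs" using bracket_vectorsD by (auto simp: heads_def)
  from card_mono[OF finite_heads this] show ?thesis by simp
qed

lemma bv_count_0: "bv_count (Suc n) 0 k = 0"
  using card_heads_ge[of _ n] by (fastforce simp: bv_count_def)

lemma bv_count_ge_eq_0: "n < r \<Longrightarrow> bv_count_ge n r k = 0"
  using card_heads_le[of _ n] by (fastforce simp: bv_count_ge_def)

lemma bv_count_ge_split: "bv_count_ge n r k = bv_count n r k + bv_count_ge n (Suc r) k"
  unfolding bv_count_def bv_count_ge_def
  by (subst card_Un_disjoint[symmetric]) (auto intro: arg_cong[of _ _ card])

text \<open>A nonempty vector has the distinct heads 0 and its length, so \<open>r = 1\<close>
  imposes no restriction and gives the total.\<close>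

lemma bv_count_ge_1:
  "bv_count_ge (Suc n) 1 k = card {xs \<in> bracket_vectors (Suc n). nonzeros xs = k}"
  unfolding bv_count_ge_def using card_heads_ge[of _ n]
  by (intro arg_cong[of _ _ card]) auto

lemma nonzeros_Cons: "nonzeros (d # xs) = (if d = 0 then nonzeros xs else Suc (nonzeros xs))"
  by (simp add: nonzeros_def)

text \<open>Deleting the first entry is injective here: the number of admissible heads of the
  longer vector determines the deleted entry.\<close>

lemma bv_count_tl:
  assumes "1 \<le> r"
  shows "bv_count (Suc n) r k = card {xs \<in> bracket_vectors n.
     nonzeros xs = k \<and> card (heads xs) = r \<or> Suc (nonzeros xs) = k \<and> r < card (heads xs)}"
  (is "_ = card ?B")
proof -
  let ?A = "{xs \<in> bracket_vectors (Suc n). nonzeros xs = k \<and> card (heads xs) = Suc r}"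
  have A_iff: "d # xs \<in> ?A \<longleftrightarrow>
      xs \<in> ?B \<and> d \<in> heads xs \<and> card {e \<in> heads xs. d \<le> e} = r" for d xs
  proof -
    \<comment> \<open>The number of heads of \<open>xs\<close> that survive. All survive exactly for
      \<open>d = 0\<close>, where \<open>nonzeros\<close> stays the same; this yields the two
      alternatives in \<open>?B\<close>.\<close>
    define u where "u = card {e \<in> heads xs. d \<le> e}"
    have "u \<le> card (heads xs)" unfolding u_def by (intro card_mono) auto
    moreover have "u = card (heads xs) \<longleftrightarrow> d = 0" if "d \<in> heads xs"
      unfolding u_def using that by (intro upper_section_card_full_iff) simp_all
    moreover have "card (heads (d # xs)) = Suc u" by (simp add: card_heads_Cons u_def)
    ultimately show ?thesis
      unfolding u_def[symmetric] mem_Collect_eq Cons_in_bracket_vectors nonzeros_Cons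
      by (cases "d = 0") (simp_all, linarith+)
  qed
  have ex1: "\<exists>!d. d \<in> heads xs \<and> card {e \<in> heads xs. d \<le> e} = r" if "xs \<in> ?B" for xs
  proof (rule ex1_upper_section_card)
    show "r \<le> card (heads xs)" using that by fastforce
  qed (use assms in simp_all)
  have Cons: "\<exists>d zs. xs = d # zs" if "xs \<in> ?A" for xs
    using that bracket_vectorsD(1)[of xs "Suc n"] by (cases xs) simp_all
  have "bij_betw tl ?A ?B"
  proof (rule bij_betw_imageI)
    show "inj_on tl ?A"
    proof (rule inj_onI)
      fix xs ys assume a: "xs \<in> ?A" "ys \<in> ?A" "tl xs = tl ys"
      then obtain d e zs where z: "xs = d # zs" "ys = e # zs"
        using Cons[OF a(1)] Cons[OF a(2)] by auto
      show "xs = ys" using a(1,2) ex1[of zs] unfolding z A_iff by auto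
    qed
    show "tl ` ?A = ?B"
    proof (intro equalityI subsetI)
      fix ys assume "ys \<in> tl ` ?A"
      then obtain d where "d # ys \<in> ?A" using Cons by force
      thus "ys \<in> ?B" unfolding A_iff by simp
    next
      fix ys assume ys: "ys \<in> ?B"
      then obtain d where "d \<in> heads ys \<and> card {e \<in> heads ys. d \<le> e} = r"
        using ex1 by blast
      hence "d # ys \<in> ?A" unfolding A_iff using ys by simp
      thus "ys \<in> tl ` ?A" by (intro image_eqI[of _ _ "d # ys"]) auto
    qed
  qed
  thus ?thesis unfolding bv_count_def by (rule bij_betw_same_card)
qed

text \<open>A first entry 0 adds a maximal interval to the \<open>r - 1\<close> of the tail. A
  nonzero one merges some of the tail's maximal intervals, of which there must be at least
  \<open>r\<close>, into one.\<close>

lemma bv_count_Suc_Suc: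
  assumes "1 \<le> r"
  shows "bv_count (Suc n) r (Suc k) = bv_count n (r - 1) (Suc k) + bv_count_ge n r k"
  unfolding bv_count_tl[OF assms] unfolding bv_count_def bv_count_ge_def
  by (subst card_Un_disjoint[symmetric]) (use assms in \<open>auto intro: arg_cong[of _ _ card]\<close>)

lemma bv_count_Suc_0:
  assumes "1 \<le> r"
  shows "bv_count (Suc n) r 0 = bv_count n (r - 1) 0"
  unfolding bv_count_tl[OF assms] unfolding bv_count_def
  by (rule arg_cong[of _ _ card]) (use assms in auto)

section \<open>Initial values and closed form\<close>

lemma bracket_vectors_0: "bracket_vectors 0 = {[]}"
  by (auto simp: bracket_vectors_def)

lemma heads_Nil: "heads [] = {0}"
  by (auto simp: heads_def)

lemma bv_count_zero_length: "bv_count 0 r k = (if r = 0 \<and> k = 0 then 1 else 0)"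
proof -
  have "{xs \<in> bracket_vectors 0. nonzeros xs = k \<and> card (heads xs) = Suc r} =
      (if r = 0 \<and> k = 0 then {[]} else {})"
    by (auto simp: bracket_vectors_0 heads_Nil nonzeros_def)
  thus ?thesis by (simp add: bv_count_def)
qed

lemma bv_count_no_nonzeros: "bv_count n r 0 = (if r = n then 1 else 0)"
proof (induction n arbitrary: r)
  case (Suc n)
  show ?case
    by (cases "r = 0") (auto simp: bv_count_0 bv_count_Suc_0 Suc)
qed (simp add: bv_count_zero_length)

lemma bv_count_ge_no_nonzeros: "r \<le> n \<Longrightarrow> bv_count_ge n r 0 = 1"
proof (induction rule: inc_induct)
  case base
  show ?case by (subst bv_count_ge_split) (simp add: bv_count_no_nonzeros bv_count_ge_eq_0)
next
  case (step r)
  thus ?case by (subst bv_count_ge_split) (simp add: bv_count_no_nonzeros)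
qed

text \<open>The parameter \<open>t = n - r\<close> avoids truncated subtraction.\<close>

lemma bv_count_ge_formula_if:
  assumes A: "\<And>t r. t + r = n \<Longrightarrow> 1 \<le> t \<Longrightarrow>
      n * bv_count n r (Suc k) = r * (n choose Suc k) * ((t - 1) choose k)"
    and top: "bv_count n n (Suc k) = 0"
  shows "t + r + 1 = n \<Longrightarrow> n * bv_count_ge n (Suc r) (Suc k) =
      (n choose Suc k) * ((Suc t choose Suc (Suc k)) + r * (t choose Suc k))"
proof (induction t arbitrary: r)
  case 0
  hence n: "n = Suc r" by simp
  show ?case
    using top by (subst bv_count_ge_split) (simp add: n bv_count_ge_eq_0)
next
  case (Suc t)
  have "n * bv_count_ge n (Suc r) (Suc k) =
      Suc r * (n choose Suc k) * (t choose k) +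
      (n choose Suc k) * ((Suc t choose Suc (Suc k)) + Suc r * (t choose Suc k))"
    using A[of "Suc t" "Suc r"] Suc.IH[of "Suc r"] Suc.prems
    by (subst bv_count_ge_split) (simp add: distrib_left)
  \<comment> \<open>Pascal's rule twice: it joins the terms with factor \<open>Suc r\<close>, then
    one copy of the result with \<open>Suc t choose Suc (Suc k)\<close>.\<close>
  also have "\<dots> = (n choose Suc k) *
      ((Suc (Suc t) choose Suc (Suc k)) + r * (Suc t choose Suc k))"
    by (simp add: algebra_simps)
  finally show ?case .
qed

text \<open>With \<open>xs ! i\<close> read as the number of proper descendants of vertex
  \<open>i\<close> in preorder, this counts plane forests with \<open>n\<close> vertices,
  \<open>r\<close> trees and \<open>Suc k\<close> inner vertices. The case \<open>r = n\<close> is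
  separate: at \<open>t = 0\<close> truncation gives \<open>0 choose k\<close>, which is 1 for
  \<open>k = 0\<close>, whereas the count is 0. The summation lemma takes the formula as a
  hypothesis so that it can be fed the induction hypothesis here.\<close>

lemma bv_count_formula:
  "1 \<le> n \<Longrightarrow> bv_count n n (Suc k) = 0 \<and> (\<forall>t r. t + r = n \<longrightarrow> 1 \<le> t \<longrightarrow>
     n * bv_count n r (Suc k) = r * (n choose Suc k) * ((t - 1) choose k))"
proof (induction n arbitrary: k rule: dec_induct)
  case base
  have "bv_count (Suc 0) 1 (Suc k) = 0"
    by (subst bv_count_Suc_Suc) (simp_all add: bv_count_zero_length bv_count_ge_eq_0)
  moreover have "r = 0" if "t + r = 1" "1 \<le> t" for t r :: nat using that by linarith
  ultimately show ?case using bv_count_0[of 0] by fastforce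
next
  case (step n)
  have top: "bv_count (Suc n) (Suc n) (Suc k) = 0"
    using step.IH[of k] by (subst bv_count_Suc_Suc) (simp_all add: bv_count_ge_eq_0)
  \<comment> \<open>The summed formula with \<open>k\<close> in place of \<open>Suc k\<close>; for
    \<open>k = 0\<close> both sides equal \<open>n\<close>.\<close>
  have ge: "n * bv_count_ge n (Suc r) k =
      (n choose k) * ((Suc t choose Suc k) + r * (t choose k))" if "t + r + 1 = n" for t r
  proof (cases k)
    case 0
    thus ?thesis using that by (simp add: bv_count_ge_no_nonzeros)
  next
    case (Suc k')
    show ?thesis
      unfolding Suc by (rule bv_count_ge_formula_if) (use step.IH[of k'] that in auto)
  qed
  have "Suc n * bv_count (Suc n) r (Suc k) = r * (Suc n choose Suc k) * ((t - 1) choose k)"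
    if "t + r = Suc n" "1 \<le> t" for t r
  proof (cases r)
    case 0
    thus ?thesis by (simp add: bv_count_0)
  next
    case (Suc r')
    obtain t' where t: "t = Suc t'" using \<open>1 \<le> t\<close> by (cases t) auto
    have n: "n = t' + r' + 1" using that Suc t by simp
    \<comment> \<open>The goal is \<open>r * X\<close> on the right. In fact \<open>1\<close>,
      Pascal's rule merges the two terms with factor \<open>r'\<close> into
      \<open>r' * X\<close>.\<close>
    define X where "X = (Suc n choose Suc k) * (t' choose k)"
    have "n * bv_count (Suc n) r (Suc k) =
        n * bv_count n r' (Suc k) + n * bv_count_ge n (Suc r') k"
      using bv_count_Suc_Suc[of r n k] Suc by (simp add: distrib_left)
    also have "n * bv_count n r' (Suc k) = r' * (n choose Suc k) * (t' choose k)"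
      using step.IH[of k] n by auto
    also have "n * bv_count_ge n (Suc r') k =
        (n choose k) * ((Suc t' choose Suc k) + r' * (t' choose k))"
      using ge n by simp
    finally have 1: "n * bv_count (Suc n) r (Suc k) =
        r' * X + (n choose k) * (Suc t' choose Suc k)"
      by (simp add: X_def algebra_simps)
    \<comment> \<open>The absorption identity for both binomials; the auxiliary factor
      \<open>Suc k\<close> is cancelled afterwards.\<close>
    have "Suc k * (Suc n * ((n choose k) * (Suc t' choose Suc k))) =
        (Suc n * (n choose k)) * (Suc k * (Suc t' choose Suc k))"
      by (simp only: mult_ac)
    also have "\<dots> = Suc k * (Suc t' * X)"
      unfolding Suc_times_binomial X_def
      by (simp only: Suc_times_binomial_eq[of n k] mult_ac)
    finally have 2: "Suc n * ((n choose k) * (Suc t' choose Suc k)) = Suc t' * X"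
      by (simp only: mult_cancel1) simp
    have "n * (Suc n * bv_count (Suc n) r (Suc k)) =
        Suc n * r' * X + Suc n * ((n choose k) * (Suc t' choose Suc k))"
      using arg_cong[OF 1, of "\<lambda>x. Suc n * x"] by (simp add: algebra_simps)
    \<comment> \<open>From \<open>n = t' + r' + 1\<close> and \<open>r = Suc r'\<close> one gets
      \<open>Suc n * r' + Suc t' = n * r\<close>.\<close>
    also have "\<dots> = n * (r * X)"
      unfolding 2 using n Suc by (simp add: algebra_simps)
    finally have "Suc n * bv_count (Suc n) r (Suc k) = r * X"
      using n by (simp only: mult_cancel1) simp
    thus ?thesis using t by (simp add: X_def mult.assoc)
  qed
  thus ?case using top by blast
qed

text \<open>These are the Narayana numbers. In the summed formula \<open>r = 0\<close> removes the
  second term, and at least one maximal interval is no restriction.\<close>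

lemma card_bracket_vectors:
  "Suc n * card {xs \<in> bracket_vectors (Suc n). nonzeros xs = k} =
     (Suc n choose k) * (Suc n choose Suc k)"
proof (cases k)
  case 0
  thus ?thesis unfolding bv_count_ge_1[symmetric] by (simp add: bv_count_ge_no_nonzeros)
next
  case (Suc k')
  show ?thesis
    unfolding bv_count_ge_1[symmetric] Suc
    using bv_count_ge_formula_if[of "Suc n" k' n 0] bv_count_formula[of "Suc n" k'] by simp
qed

text \<open>The product is the Narayana number counting rank \<open>k - 1\<close>: for
  \<open>n = 0\<close>, \<open>k = 1\<close> it equals 1, while rank 1 does not occur. So the
  formula is attached to \<open>k - 1\<close>; the equality of the two counts holds in every rank
  and is also given at \<open>k\<close>.\<close>

theorem corollary5p14:
  fixes n k :: nat
  assumes "1 \<le> k" and "k \<le> n + 1"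
  shows "card (Tr k n) = num_NC_of_rank n k \<and>
         card (Tr (k - 1) n) = num_NC_of_rank n (k - 1) \<and>
         real (num_NC_of_rank n (k - 1)) =
           1 / real (n + 1) * real ((n + 1) choose k) * real ((n + 1) choose (k - 1))"
proof -
  have "(n + 1) * num_NC_of_rank n (k - 1) = ((n + 1) choose (k - 1)) * ((n + 1) choose k)"
    using card_bracket_vectors[of n "k - 1"] assms(1) by (simp add: num_NC_of_rank_eq)
  hence "real (n + 1) * real (num_NC_of_rank n (k - 1)) =
      real ((n + 1) choose (k - 1)) * real ((n + 1) choose k)"
    by (simp only: of_nat_mult[symmetric])
  hence "real (num_NC_of_rank n (k - 1)) =
      1 / real (n + 1) * real ((n + 1) choose k) * real ((n + 1) choose (k - 1))"
    by (simp add: field_simps del: of_nat_add of_nat_Suc)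
  thus ?thesis by (simp add: card_Tr num_NC_of_rank_eq)
qed

end
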